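(* For $d\ge 2k$, the Klee–Novik complex $M(k,d)$ belongs to $\mathcal{W}_k(d)$.
   Context: Simplicial complexes are finite and contain the empty set as a face. The Klee–Novik complexes: for $d\ge 1$, let $S^{d+1}_{2d+4}$ be the join of $d+2$ copies of the two-point complex $S^0_2$ with disjoint vertex sets $\{x_i,y_i\}$, $1\le i\le d+2$ (the boundary complex of the $(d+2)$-dimensional cross polytope). Each facet $\sigma$ contains exactly one of $x_i,y_i$ for each $i$; encode it by the sign sequence $(\varepsilon_1,\dots,\varepsilon_{d+2})$ with $\varepsilon_i=+$ if $x_i\in\sigma$ and $\varepsilon_i=-$ if $y_i\in\sigma$. A sign change is an index $1\le i\le d+1$ with $\varepsilon_{i+1}\ne\varepsilon_i$. For $0\le k\le d$, $\overline{M}(k,d)$ is the pure $(d+1)$-dimensional subcomplex of $S^{d+1}_{2d+4}$ whose facets are those with at most $k$ sign changes, and $M(k,d):=\partial\overline{M}(k,d)$ is its boundary, i.e. the pure subcomplex whose facets are the $d$-faces lying in exactly one facet of $\overline{M}(k,d)$. For a finite set $\alpha$, $\overline{\alpha}$ is the complex of all subsets of $\alpha$, $\partial\alpha$ the complex of all proper subsets, and $\dim(\alpha)=\#(\alpha)-1$; $\ast$ denotes join. The standard sphere $S^d_{d+2}$ is the boundary complex of a $(d+1)$-simplex. Bistellar moves: let $X$ be $d$-dimensional and $\alpha,\beta$ disjoint non-empty finite sets with $\dim(\alpha)+\dim(\beta)=d$ such that the induced subcomplex of $X$ on $\alpha\sqcup\beta$ is $\overline{\alpha}\ast\partial\beta$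 (if $\beta$ is a single vertex this means $\beta$ is a new vertex not in $X$). The complex $(X\setminus(\overline{\alpha}\ast\partial\beta))\cup(\partial\alpha\ast\overline{\beta})$ is obtained from $X$ by the bistellar move $\alpha\mapsto\beta$, of index $\dim(\beta)$. For $0\le k\le d+1$, a $d$-dimensional complex is a $k$-stellated $d$-sphere if it is obtained from $S^d_{d+2}$ by a finite (possibly empty) sequence of bistellar moves each of index $<k$. For $0\le k\le d$, $\mathcal{W}_k(d)$ is the class of connected $d$-dimensional simplicial complexes all of whose vertex-links are $k$-stellated $(d-1)$-spheres.
   Formalization: The case k = 0 is excluded (k ≥ 1 is assumed): M(0,d) is a disjoint union of two standard d-spheres, hence not connected, so it is not in W_0(d) and the claim fails there. *)

theory Defs
  imports Main "HOL-Library.Infinite_Typeclass"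
begin

type_synonym 'a complex = "'a set set"

definition simplicial_complex :: "'a complex \<Rightarrow> bool" where
  "simplicial_complex X \<longleftrightarrow>
     finite X \<and> {} \<in> X \<and> (\<forall>\<sigma>\<in>X. finite \<sigma> \<and> (\<forall>\<tau>. \<tau> \<subseteq> \<sigma> \<longrightarrow> \<tau> \<in> X))"

(* Dimensions are integers: the empty face has dimension -1. *)
definition face_dim :: "'a set \<Rightarrow> int" where
  "face_dim \<alpha> = int (card \<alpha>) - 1"

definition complex_dim :: "'a complex \<Rightarrow> int" where
  "complex_dim X = Max (face_dim ` X)"

definition facet :: "'a complex \<Rightarrow> 'a set \<Rightarrow> bool" where
  "facet X \<sigma> \<longleftrightarrow> \<sigma> \<in> X \<and> \<not> (\<exists>\<tau>\<in>X. \<sigma> \<subset> \<tau>)"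

definition generated_complex :: "'a set set \<Rightarrow> 'a complex" where
  "generated_complex F = insert {} {\<tau>. \<exists>\<sigma>\<in>F. \<tau> \<subseteq> \<sigma>}"

definition full_simplex :: "'a set \<Rightarrow> 'a complex" where
  "full_simplex \<alpha> = {\<sigma>. \<sigma> \<subseteq> \<alpha>}"

definition simplex_boundary :: "'a set \<Rightarrow> 'a complex" where
  "simplex_boundary \<alpha> = {\<sigma>. \<sigma> \<subset> \<alpha>}"

(* Only used for complexes with disjoint vertex sets. *)
definition join :: "'a complex \<Rightarrow> 'a complex \<Rightarrow> 'a complex" where
  "join X Y = {\<sigma> \<union> \<tau> | \<sigma> \<tau>. \<sigma> \<in> X \<and> \<tau> \<in> Y}"

definition induced_subcomplex :: "'a complex \<Rightarrow> 'a set \<Rightarrow> 'a complex" where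
  "induced_subcomplex X U = {\<sigma> \<in> X. \<sigma> \<subseteq> U}"

definition vertices :: "'a complex \<Rightarrow> 'a set" where
  "vertices X = {v. {v} \<in> X}"

definition link :: "'a complex \<Rightarrow> 'a \<Rightarrow> 'a complex" where
  "link X v = {\<sigma> \<in> X. v \<notin> \<sigma> \<and> insert v \<sigma> \<in> X}"

(* Connectedness of a complex is connectedness of its edge graph. *)
definition connected_complex :: "'a complex \<Rightarrow> bool" where
  "connected_complex X \<longleftrightarrow>
     (\<forall>u\<in>vertices X. \<forall>v\<in>vertices X. (u, v) \<in> {(a, b). {a, b} \<in> X}\<^sup>*)"

(* The boundary complex of a (d+1)-simplex, on an arbitrary vertex set. *)
definition standard_sphere :: "int \<Rightarrow> 'a complex \<Rightarrow> bool" where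
  "standard_sphere d X \<longleftrightarrow>
     (\<exists>V. finite V \<and> int (card V) = d + 2 \<and> X = simplex_boundary V)"

(* If \<beta> = {b}, then join (full_simplex \<alpha>) (simplex_boundary \<beta>) = full_simplex \<alpha>, and the
   condition on the induced subcomplex already forces b to be a new vertex. *)
definition bistellar_move ::
  "int \<Rightarrow> 'a complex \<Rightarrow> 'a set \<Rightarrow> 'a set \<Rightarrow> 'a complex \<Rightarrow> bool" where
  "bistellar_move d X \<alpha> \<beta> Y \<longleftrightarrow>
     simplicial_complex X \<and> complex_dim X = d \<and>
     finite \<alpha> \<and> finite \<beta> \<and> \<alpha> \<noteq> {} \<and> \<beta> \<noteq> {} \<and> \<alpha> \<inter> \<beta> = {} \<and>
     face_dim \<alpha> + face_dim \<beta> = d \<and>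
     induced_subcomplex X (\<alpha> \<union> \<beta>) = join (full_simplex \<alpha>) (simplex_boundary \<beta>) \<and>
     Y = (X - join (full_simplex \<alpha>) (simplex_boundary \<beta>))
           \<union> join (simplex_boundary \<alpha>) (full_simplex \<beta>)"

(* All vertices are taken from one type.  It has to be infinite so that a new vertex is
   always available for a move of index 0. *)
inductive stellated_sphere :: "nat \<Rightarrow> int \<Rightarrow> ('a::infinite) complex \<Rightarrow> bool"
  for k :: nat and d :: int where
  standard: "standard_sphere d X \<Longrightarrow> stellated_sphere k d X"
| move: "stellated_sphere k d X \<Longrightarrow> bistellar_move d X \<alpha> \<beta> Y \<Longrightarrow> face_dim \<beta> < int k
         \<Longrightarrow> stellated_sphere k d Y"

definition walkup_class :: "nat \<Rightarrow> nat \<Rightarrow> ('a::infinite) complex set" where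
  "walkup_class k d = {X. simplicial_complex X \<and> complex_dim X = int d \<and> connected_complex X \<and>
     (\<forall>v\<in>vertices X. stellated_sphere k (int d - 1) (link X v))}"

type_synonym kn_vertex = "nat \<times> bool"

abbreviation vx :: "nat \<Rightarrow> kn_vertex" where "vx i \<equiv> (i, True)"
abbreviation vy :: "nat \<Rightarrow> kn_vertex" where "vy i \<equiv> (i, False)"

(* S^0_2 on {x_i, y_i} is the boundary of the edge x_i y_i; join of the copies i = 1, ..., n. *)
primrec join_of_pairs :: "nat \<Rightarrow> kn_vertex complex" where
  "join_of_pairs 0 = {{}}"
| "join_of_pairs (Suc n) = join (join_of_pairs n) (simplex_boundary {vx (Suc n), vy (Suc n)})"

definition cross_sphere :: "nat \<Rightarrow> kn_vertex complex" where
  "cross_sphere d = join_of_pairs (d + 2)"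

(* The sign at i is + iff x_i lies in the facet. *)
definition sign_changes :: "nat \<Rightarrow> kn_vertex set \<Rightarrow> nat" where
  "sign_changes d \<sigma> = card {i \<in> {1..d + 1}. (vx (i + 1) \<in> \<sigma>) \<noteq> (vx i \<in> \<sigma>)}"

definition klee_novik_ball :: "nat \<Rightarrow> nat \<Rightarrow> kn_vertex complex" where
  "klee_novik_ball k d =
     generated_complex {\<sigma>. facet (cross_sphere d) \<sigma> \<and> sign_changes d \<sigma> \<le> k}"

(* For k = 0 this is the disjoint union of two standard d-spheres (the boundaries of the
   simplices x_1 ... x_{d+2} and y_1 ... y_{d+2}), hence it is not connected. *)
definition klee_novik :: "nat \<Rightarrow> nat \<Rightarrow> kn_vertex complex" where
  "klee_novik k d = generated_complex
     {\<tau> \<in> klee_novik_ball k d. face_dim \<tau> = int d \<and>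
        (\<exists>!\<sigma>. facet (klee_novik_ball k d) \<sigma> \<and> \<tau> \<subseteq> \<sigma>)}"

end

theory Submission
  imports Defs
begin

text \<open>The link of a vertex v in position i consists of the boundary ridges of the set of sign vectors
  on the remaining positions with at most k sign changes, where v supplies the sign at i. Sign
  vectors are ordered pointwise by the number of sign changes between i and each position m.
  Adding them one by one along this order is a shelling: a new sign vector meets the previous ones
  in the faces that do not contain its restriction R, where R consists of the vertices
  whose sign differs from that of their neighbour on the side of i. Since R has at most k
  elements, each step changes the boundary by the bistellar move from the complement of R to R,
  of index less than k.\<close>

text \<open>The order works because of parity. The sign at a position is the sign at i, toggled once
  per change on the way; so the counts determine the sign vector, and vectors that agree at a
  position have counts of equal parity there. If a second vector agrees with a first one wherever
  the first changes outward from i, its counts never fall behind: a deficit of one at such a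
  position has the wrong parity. Agreement at the repeats bounds the counts from the other side.
  Hence sections containing R lie above the given one, and sections containing its complement lie
  below; the latter keep to the bound k, because the total number of changes is the sum of the
  counts at the two ends. The pointwise order is only partial, so the sum of all counts serves as a
  numerical rank. The boundary must also be nonempty, of the right dimension and connected. This
  rests on vectors with exactly k changes, none of them between positions 1 and 2: flipping the
  first sign then leaves the ball.\<close>

section \<open>Sections (facets of a cross polytope), flips and boundaries\<close>

text \<open>The index set is arbitrary because a vertex link lives on \<open>{1..n}\<close> with one
  position removed.\<close>

definition sections :: "nat set \<Rightarrow> kn_vertex set set" where
  "sections I = range (\<lambda>e. (\<lambda>j. (j, e j)) ` I)"

definition flip :: "kn_vertex \<Rightarrow> kn_vertex set \<Rightarrow> kn_vertex set" where
  "flip v \<sigma> = insert (fst v, \<not> snd v) (\<sigma> - {v})"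

text \<open>Only two sections contain a given ridge, so one absent \<open>flip\<close> already makes
  it a boundary ridge. The empty face is not added by hand: without boundary ridges this set is
  empty.\<close>

definition boundary :: "kn_vertex set set \<Rightarrow> kn_vertex complex" where
  "boundary F = {\<rho>. \<exists>\<sigma>\<in>F. \<exists>v\<in>\<sigma>. flip v \<sigma> \<notin> F \<and> \<rho> \<subseteq> \<sigma> - {v}}"

lemma sections_iff:
  "\<sigma> \<in> sections I \<longleftrightarrow>
     (\<forall>j b. (j, b) \<in> \<sigma> \<longrightarrow> j \<in> I) \<and> (\<forall>j\<in>I. (j, True) \<in> \<sigma> \<longleftrightarrow> (j, False) \<notin> \<sigma>)"
proof
  assume "\<sigma> \<in> sections I"
  then show "(\<forall>j b. (j, b) \<in> \<sigma> \<longrightarrow> j \<in> I) \<and> (\<forall>j\<in>I. (j, True) \<in> \<sigma> \<longleftrightarrow> (j, False) \<notin> \<sigma>)"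
    by (auto simp: sections_def)
next
  assume *: "(\<forall>j b. (j, b) \<in> \<sigma> \<longrightarrow> j \<in> I) \<and> (\<forall>j\<in>I. (j, True) \<in> \<sigma> \<longleftrightarrow> (j, False) \<notin> \<sigma>)"
  have "(j, b) \<in> \<sigma> \<longleftrightarrow> (j, b) \<in> (\<lambda>j. (j, (j, True) \<in> \<sigma>)) ` I" for j b
    using * by (cases b) auto
  then have eq: "\<sigma> = (\<lambda>j. (j, (j, True) \<in> \<sigma>)) ` I"
    unfolding set_eq_iff split_paired_All by blast
  show "\<sigma> \<in> sections I" unfolding sections_def
    by (rule image_eqI[where x = "\<lambda>j. (j, True) \<in> \<sigma>"]) (rule eq, rule UNIV_I)
qed

lemma sections_mem_iff:
  assumes "\<sigma> \<in> sections I"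
  shows "(j, b) \<in> \<sigma> \<longleftrightarrow> j \<in> I \<and> ((j, True) \<in> \<sigma> \<longleftrightarrow> b)"
  using assms unfolding sections_iff by (cases b) auto

lemma sections_card:
  assumes "\<sigma> \<in> sections I" shows "card \<sigma> = card I"
  using assms by (auto simp: sections_def intro!: card_image inj_onI)

lemma sections_finite:
  assumes "finite I" "\<sigma> \<in> sections I" shows "finite \<sigma>"
  using assms by (auto simp: sections_def)

lemma finite_sections: "finite I \<Longrightarrow> finite (sections I)"
  by (rule finite_subset[of _ "Pow (I \<times> UNIV)"]) (auto simp: sections_def)

lemma flip_sections: "\<sigma> \<in> sections I \<Longrightarrow> v \<in> \<sigma> \<Longrightarrow> flip v \<sigma> \<in> sections I"
  by (cases v; cases "snd v") (auto simp: sections_iff flip_def)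

lemma flip_flip:
  "\<sigma> \<in> sections I \<Longrightarrow> v \<in> \<sigma> \<Longrightarrow> flip (fst v, \<not> snd v) (flip v \<sigma>) = \<sigma>"
  by (cases v; cases "snd v") (auto simp: sections_iff flip_def)

lemma flip_minus:
  "\<sigma> \<in> sections I \<Longrightarrow> v \<in> \<sigma> \<Longrightarrow> flip v \<sigma> - {(fst v, \<not> snd v)} = \<sigma> - {v}"
  by (cases v; cases "snd v") (auto simp: sections_iff flip_def)

lemma flip_neq: "v \<in> \<sigma> \<Longrightarrow> flip v \<sigma> \<noteq> \<sigma>"
  by (cases v) (auto simp: flip_def)

text \<open>A ridge fixes the sign at all positions but one, and there two signs remain.\<close>

lemma sections_facet_through_ridge:
  assumes "\<sigma> \<in> sections I" "v \<in> \<sigma>" "\<tau> \<in> sections I" "\<sigma> - {v} \<subseteq> \<tau>"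
  shows "\<tau> = \<sigma> \<or> \<tau> = flip v \<sigma>"
proof -
  obtain i b where v: "v = (i, b)" by (cases v)
  have i: "i \<in> I" using assms v by (auto simp: sections_iff)
  have *: "(j, c) \<in> \<sigma> \<longleftrightarrow> (j, c) \<in> \<tau>" if "j \<noteq> i" for j c
  proof -
    have "(j, s) \<in> \<tau>" if "(j, s) \<in> \<sigma>" for s using that \<open>j \<noteq> i\<close> assms(4) v by auto
    then show ?thesis using assms(1,3) unfolding sections_iff by (metis (full_types))
  qed
  show ?thesis
  proof (cases "(i, b) \<in> \<tau>")
    case True
    have "(j, c) \<in> \<sigma> \<longleftrightarrow> (j, c) \<in> \<tau>" for j c
      using * True assms(1-3) i v sections_mem_iff[of \<sigma> I] sections_mem_iff[of \<tau> I]
      by (metis (full_types))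
    then show ?thesis by auto
  next
    case False
    then have "(i, \<not> b) \<in> \<tau>" using assms(3) i by (cases b) (auto simp: sections_iff)
    have "(j, c) \<in> \<tau> \<longleftrightarrow> (j, c) \<in> flip v \<sigma>" for j c
      using * False \<open>(i, \<not> b) \<in> \<tau>\<close> assms(2) v by (cases "j = i"; cases "c = b") (auto simp: flip_def)
    then show ?thesis by auto
  qed
qed

lemma boundary_mono_face: "\<rho> \<in> boundary F \<Longrightarrow> \<rho>' \<subseteq> \<rho> \<Longrightarrow> \<rho>' \<in> boundary F"
  unfolding boundary_def by blast

lemma boundary_card:
  assumes "finite I" "F \<subseteq> sections I" "\<rho> \<in> boundary F"
  shows "card \<rho> < card I"
proof -
  obtain \<sigma> v where s: "\<sigma> \<in> F" "v \<in> \<sigma>" "\<rho> \<subseteq> \<sigma> - {v}" using assms unfolding boundary_def by auto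
  have "card \<rho> < card \<sigma>"
    using s assms sections_finite by (intro psubset_card_mono) blast+
  then show ?thesis using sections_card s assms by (metis subsetD)
qed

lemma boundary_simplicial:
  assumes "finite I" "F \<subseteq> sections I" "boundary F \<noteq> {}"
  shows "simplicial_complex (boundary F)"
proof -
  have *: "\<rho> \<subseteq> I \<times> UNIV" if \<rho>: "\<rho> \<in> boundary F" for \<rho>
  proof -
    obtain \<sigma> where "\<sigma> \<in> F" "\<rho> \<subseteq> \<sigma>" using \<rho> unfolding boundary_def by auto
    then show ?thesis using assms(2) by (fastforce simp: sections_def)
  qed
  have fin: "finite (I \<times> (UNIV :: bool set))" using assms by simp
  have "boundary F \<subseteq> Pow (I \<times> UNIV)" using * by blast
  then have "finite (boundary F)" using fin finite_subset by blast
  then show ?thesis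
    unfolding simplicial_complex_def
    using assms(3) boundary_mono_face * fin finite_subset by (metis all_not_in_conv empty_subsetI)
qed

lemma boundary_dim:
  assumes "finite I" "card I = N + 1" "F \<subseteq> sections I" "\<rho> \<in> boundary F" "card \<rho> = N"
  shows "complex_dim (boundary F) = int N - 1"
  unfolding complex_dim_def
proof (rule Max_eqI)
  have "simplicial_complex (boundary F)" using boundary_simplicial assms by blast
  then show "finite (face_dim ` boundary F)" by (simp add: simplicial_complex_def)
  show "int N - 1 \<in> face_dim ` boundary F" using assms(4,5) by (auto simp: face_dim_def)
  show "y \<le> int N - 1" if "y \<in> face_dim ` boundary F" for y
    using that boundary_card[OF assms(1,3)] assms(2) by (auto simp: face_dim_def) fastforce
qed

section \<open>Bistellar moves along a shelling order\<close>

text \<open>Splitting a face along \<open>\<beta>\<close> turns the removed side of a move into a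
  condition on subsets of one simplex, which can be compared with \<open>boundary\<close> directly.
  The next lemma does this for the inserted side.\<close>

lemma join_full_simplex_boundary:
  assumes "\<beta> \<subseteq> \<sigma>"
  shows "join (full_simplex (\<sigma> - \<beta>)) (simplex_boundary \<beta>) = {\<rho>. \<rho> \<subseteq> \<sigma> \<and> \<not> \<beta> \<subseteq> \<rho>}"
proof (intro set_eqI iffI)
  fix \<rho> assume "\<rho> \<in> {\<rho>. \<rho> \<subseteq> \<sigma> \<and> \<not> \<beta> \<subseteq> \<rho>}"
  then have "\<rho> = (\<rho> - \<beta>) \<union> (\<rho> \<inter> \<beta>)" "\<rho> - \<beta> \<subseteq> \<sigma> - \<beta>" "\<rho> \<inter> \<beta> \<subset> \<beta>" by auto
  then show "\<rho> \<in> join (full_simplex (\<sigma> - \<beta>)) (simplex_boundary \<beta>)"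
    unfolding join_def full_simplex_def simplex_boundary_def by blast
qed (use assms in \<open>auto simp: join_def full_simplex_def simplex_boundary_def\<close>)

lemma join_simplex_boundary_full:
  assumes "\<beta> \<subseteq> \<sigma>"
  shows "join (simplex_boundary (\<sigma> - \<beta>)) (full_simplex \<beta>) = {\<rho>. \<rho> \<subseteq> \<sigma> \<and> \<not> \<sigma> - \<beta> \<subseteq> \<rho>}"
proof (intro set_eqI iffI)
  fix \<rho> assume "\<rho> \<in> {\<rho>. \<rho> \<subseteq> \<sigma> \<and> \<not> \<sigma> - \<beta> \<subseteq> \<rho>}"
  then have "\<rho> = (\<rho> - \<beta>) \<union> (\<rho> \<inter> \<beta>)" "\<rho> - \<beta> \<subset> \<sigma> - \<beta>" "\<rho> \<inter> \<beta> \<subseteq> \<beta>" by auto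
  then show "\<rho> \<in> join (simplex_boundary (\<sigma> - \<beta>)) (full_simplex \<beta>)"
    unfolding join_def full_simplex_def simplex_boundary_def by blast
qed (use assms in \<open>auto simp: join_def full_simplex_def simplex_boundary_def\<close>)

text \<open>The two monotonicity hypotheses say that among all facets containing the restriction of a facet
  that facet comes first, and that among all sections containing the complement of the restriction it
  comes last. The second one makes this complement an interior face once the facet is added, so
  that it really disappears from the boundary.\<close>
lemma stellated_sphere_boundary:
  fixes \<Phi> :: "kn_vertex set \<Rightarrow> nat" and R :: "kn_vertex set \<Rightarrow> kn_vertex set"
  assumes I: "finite I" "card I = N + 1" and kN: "k \<le> N"
    and D: "D \<subseteq> sections I"
    and R: "\<And>\<sigma>. \<sigma> \<in> D \<Longrightarrow> R \<sigma> \<subseteq> \<sigma> \<and> card (R \<sigma>) \<le> k"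
    and above: "\<And>\<sigma> \<tau>. \<sigma> \<in> D \<Longrightarrow> \<tau> \<in> D \<Longrightarrow> \<tau> \<noteq> \<sigma> \<Longrightarrow> R \<sigma> \<subseteq> \<tau> \<Longrightarrow> \<Phi> \<sigma> < \<Phi> \<tau>"
    and below: "\<And>\<sigma> \<tau>. \<sigma> \<in> D \<Longrightarrow> \<tau> \<in> sections I \<Longrightarrow> \<tau> \<noteq> \<sigma> \<Longrightarrow> \<sigma> - R \<sigma> \<subseteq> \<tau>
                  \<Longrightarrow> \<tau> \<in> D \<and> \<Phi> \<tau> < \<Phi> \<sigma>"
    and F: "F \<subseteq> D" "F \<noteq> {}" and lower: "\<And>\<sigma> \<tau>. \<sigma> \<in> F \<Longrightarrow> \<tau> \<in> D \<Longrightarrow> \<Phi> \<tau> < \<Phi> \<sigma> \<Longrightarrow> \<tau> \<in> F"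
  shows "stellated_sphere k (int N - 1) (boundary F)"
  using F lower
proof (induction "card F" arbitrary: F rule: less_induct)
  case less
  have finF: "finite F" using less.prems(1) D finite_sections[OF I(1)] finite_subset by (metis)
  \<comment> \<open>Any facet of maximal potential may be the last one. Ties are harmless, since
    being a lower set is stated with strict inequality.\<close>
  have "Max (\<Phi> ` F) \<in> \<Phi> ` F" using finF less.prems(2) by (intro Max_in) auto
  then obtain \<sigma> where \<sigma>F: "\<sigma> \<in> F" "\<Phi> \<sigma> = Max (\<Phi> ` F)" by auto
  have \<sigma>: "\<sigma> \<in> F" "\<And>\<tau>. \<tau> \<in> F \<Longrightarrow> \<Phi> \<tau> \<le> \<Phi> \<sigma>"
    using \<sigma>F finF by simp_all
  have \<sigma>D: "\<sigma> \<in> D" and \<sigma>S: "\<sigma> \<in> sections I" using \<sigma> less.prems(1) D by auto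
  have fin\<sigma>: "finite \<sigma>" using \<sigma>S I sections_finite by blast
  have card\<sigma>: "card \<sigma> = N + 1" using \<sigma>S I sections_card by simp
  define F' where "F' = F - {\<sigma>}"
  define \<beta> where "\<beta> = R \<sigma>"
  have \<beta>: "\<beta> \<subseteq> \<sigma>" "card \<beta> \<le> k" using R \<sigma>D by (auto simp: \<beta>_def)
  have F'S: "F' \<subseteq> sections I" using less.prems(1) D by (auto simp: F'_def)
  show ?case
  proof (cases "F' = {}")
    case True
    then have Fs: "F = {\<sigma>}" using \<sigma> by (auto simp: F'_def)
    \<comment> \<open>No flip of a single facet stays inside, so every ridge is a boundary
      ridge.\<close>
    have "boundary F = simplex_boundary \<sigma>"
      using flip_neq[of _ \<sigma>] unfolding Fs boundary_def simplex_boundary_def by blast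
    then show ?thesis using fin\<sigma> card\<sigma>
      by (auto intro!: stellated_sphere.standard exI[of _ \<sigma>] simp: standard_sphere_def)
  next
    case False
    have "card F' < card F" unfolding F'_def using finF \<sigma>(1) by (rule card_Diff1_less)
    moreover have "F' \<subseteq> D" using less.prems(1) by (auto simp: F'_def)
    moreover have "\<tau> \<in> F'" if "\<rho> \<in> F'" "\<tau> \<in> D" "\<Phi> \<tau> < \<Phi> \<rho>" for \<rho> \<tau>
      using that less.prems(3)[of \<rho> \<tau>] \<sigma>(2)[of \<rho>] unfolding F'_def by auto
    ultimately have IH: "stellated_sphere k (int N - 1) (boundary F')"
      using False less.hyps by blast
    have up: False if "\<tau> \<in> F'" "\<beta> \<subseteq> \<tau>" for \<tau>
      using above[OF \<sigma>D, of \<tau>] that \<sigma>(2)[of \<tau>] less.prems(1) unfolding \<beta>_def F'_def by auto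
    have down: "\<tau> \<in> F'" if "\<tau> \<in> sections I" "\<tau> \<noteq> \<sigma>" "\<sigma> - \<beta> \<subseteq> \<tau>" for \<tau>
      using below[OF \<sigma>D, of \<tau>] that less.prems(3)[OF \<sigma>(1), of \<tau>] unfolding \<beta>_def F'_def by auto
    have flip_in: "flip v \<sigma> \<in> F'" if "v \<in> \<beta>" for v
    proof (rule down)
      show "flip v \<sigma> \<in> sections I" using \<sigma>S \<beta>(1) that by (intro flip_sections) auto
      show "flip v \<sigma> \<noteq> \<sigma>" using \<beta>(1) that by (intro flip_neq) auto
      show "\<sigma> - \<beta> \<subseteq> flip v \<sigma>" using that by (auto simp: flip_def)
    qed
    have flip_out: "flip v \<sigma> \<notin> F" if "v \<in> \<sigma> - \<beta>" for v
    proof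
      assume "flip v \<sigma> \<in> F"
      then have "flip v \<sigma> \<in> F'" using flip_neq[of v \<sigma>] that by (auto simp: F'_def)
      moreover have "\<beta> \<subseteq> flip v \<sigma>" using that \<beta>(1) by (auto simp: flip_def)
      ultimately show False by (rule up)
    qed
    \<comment> \<open>An empty restriction would lie in every facet of the nonempty
      \<open>F'\<close>, against \<open>up\<close>.\<close>
    have \<beta>ne: "\<beta> \<noteq> {}" using False up by blast
    have fin\<beta>: "finite \<beta>" using \<beta>(1) fin\<sigma> finite_subset by blast
    have card\<alpha>: "card (\<sigma> - \<beta>) = N + 1 - card \<beta>" using \<beta>(1) fin\<beta> card\<sigma> card_Diff_subset by metis
    have \<alpha>ne: "\<sigma> - \<beta> \<noteq> {}" using card\<alpha> \<beta>(2) kN by (intro notI) simp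
    \<comment> \<open>Such a face omits some \<open>v\<close> in \<open>\<beta>\<close>, hence lies
      in the ridge that \<open>\<sigma>\<close> shares with \<open>flip v \<sigma>\<close>; only the
      latter belongs to \<open>F'\<close>.\<close>
    have old: "\<rho> \<in> boundary F'" if \<rho>: "\<rho> \<subseteq> \<sigma>" "\<not> \<beta> \<subseteq> \<rho>" for \<rho>
    proof -
      obtain v where v: "v \<in> \<beta>" "v \<notin> \<rho>" using \<rho>(2) by blast
      let ?w = "(fst v, \<not> snd v)"
      have v\<sigma>: "v \<in> \<sigma>" using v \<beta>(1) by auto
      have "flip ?w (flip v \<sigma>) \<notin> F'" using flip_flip[OF \<sigma>S v\<sigma>] by (simp add: F'_def)
      moreover have "\<rho> \<subseteq> flip v \<sigma> - {?w}" using flip_minus[OF \<sigma>S v\<sigma>] \<rho> v by auto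
      moreover have "?w \<in> flip v \<sigma>" by (simp add: flip_def)
      ultimately show ?thesis unfolding boundary_def using flip_in[OF v(1)] by blast
    qed
    have ind: "induced_subcomplex (boundary F') (\<sigma> - \<beta> \<union> \<beta>)
        = join (full_simplex (\<sigma> - \<beta>)) (simplex_boundary \<beta>)"
    proof -
      have "\<not> \<beta> \<subseteq> \<rho>" if "\<rho> \<in> boundary F'" for \<rho>
        using that up unfolding boundary_def by blast
      then show ?thesis using old \<beta>(1)
        unfolding join_full_simplex_boundary[OF \<beta>(1)] induced_subcomplex_def by blast
    qed
    have new: "boundary F = (boundary F' - join (full_simplex (\<sigma> - \<beta>)) (simplex_boundary \<beta>))
        \<union> join (simplex_boundary (\<sigma> - \<beta>)) (full_simplex \<beta>)"
      unfolding join_full_simplex_boundary[OF \<beta>(1)] join_simplex_boundary_full[OF \<beta>(1)]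
    proof (intro set_eqI iffI)
      fix \<rho> assume "\<rho> \<in> boundary F"
      then obtain \<tau> v where \<tau>: "\<tau> \<in> F" "v \<in> \<tau>" "flip v \<tau> \<notin> F" "\<rho> \<subseteq> \<tau> - {v}"
        unfolding boundary_def by auto
      show "\<rho> \<in> boundary F' - {\<rho>. \<rho> \<subseteq> \<sigma> \<and> \<not> \<beta> \<subseteq> \<rho>} \<union> {\<rho>. \<rho> \<subseteq> \<sigma> \<and> \<not> \<sigma> - \<beta> \<subseteq> \<rho>}"
      proof (cases "\<tau> = \<sigma>")
        case True
        then have "v \<notin> \<beta>" using flip_in[of v] \<tau>(3) unfolding F'_def by blast
        then show ?thesis using True \<tau> by auto
      next
        case False
        then have \<tau>': "\<tau> \<in> F'" "flip v \<tau> \<notin> F'" using \<tau> unfolding F'_def by auto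
        have "\<rho> \<in> boundary F'" unfolding boundary_def using \<tau>' \<tau> by blast
        \<comment> \<open>Otherwise \<open>flip v \<tau>\<close>, which differs from
          \<open>\<sigma>\<close> as it is not in \<open>F\<close>, would contain the complement of
          \<open>\<beta>\<close> as well, and \<open>down\<close> would put it into
          \<open>F'\<close>.\<close>
        moreover have "\<not> \<sigma> - \<beta> \<subseteq> \<rho>"
        proof
          assume "\<sigma> - \<beta> \<subseteq> \<rho>"
          then have "\<sigma> - \<beta> \<subseteq> flip v \<tau>" using \<tau> by (auto simp: flip_def)
          moreover have "flip v \<tau> \<in> sections I" using \<tau>' F'S \<tau>(2) flip_sections by blast
          moreover have "flip v \<tau> \<noteq> \<sigma>" using \<tau> \<sigma> by auto
          ultimately show False using down \<tau>' by blast
        qed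
        ultimately show ?thesis by auto
      qed
    next
      fix \<rho>
      assume "\<rho> \<in> boundary F' - {\<rho>. \<rho> \<subseteq> \<sigma> \<and> \<not> \<beta> \<subseteq> \<rho>} \<union> {\<rho>. \<rho> \<subseteq> \<sigma> \<and> \<not> \<sigma> - \<beta> \<subseteq> \<rho>}"
      then show "\<rho> \<in> boundary F"
      proof
        assume \<rho>: "\<rho> \<in> boundary F' - {\<rho>. \<rho> \<subseteq> \<sigma> \<and> \<not> \<beta> \<subseteq> \<rho>}"
        then obtain \<tau> v where \<tau>: "\<tau> \<in> F'" "v \<in> \<tau>" "flip v \<tau> \<notin> F'" "\<rho> \<subseteq> \<tau> - {v}"
          unfolding boundary_def by auto
        \<comment> \<open>Otherwise \<open>\<rho>\<close> lies in \<open>\<sigma>\<close>; having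
          survived the removal it contains \<open>\<beta>\<close>, and then so does
          \<open>\<tau>\<close>, against \<open>up\<close>.\<close>
        have "flip v \<tau> \<noteq> \<sigma>"
        proof
          assume "flip v \<tau> = \<sigma>"
          then have "\<rho> \<subseteq> \<sigma>" using \<tau> by (auto simp: flip_def)
          then have "\<beta> \<subseteq> \<tau>" using \<rho> \<tau> by auto
          then show False using up \<tau> by blast
        qed
        then have "\<tau> \<in> F" "flip v \<tau> \<notin> F" using \<tau> unfolding F'_def by auto
        then show ?thesis unfolding boundary_def using \<tau> by blast
      next
        assume "\<rho> \<in> {\<rho>. \<rho> \<subseteq> \<sigma> \<and> \<not> \<sigma> - \<beta> \<subseteq> \<rho>}"
        then obtain v where "v \<in> \<sigma> - \<beta>" "\<rho> \<subseteq> \<sigma> - {v}" by auto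
        then show ?thesis unfolding boundary_def using flip_out \<sigma>(1) by blast
      qed
    qed
    obtain v where v: "v \<in> \<beta>" using \<beta>ne by auto
    have ridge: "\<sigma> - {v} \<in> boundary F'" using v by (intro old) auto
    have "card (\<sigma> - {v}) = N" using v \<beta>(1) card\<sigma> fin\<sigma> by auto
    then have dim: "complex_dim (boundary F') = int N - 1"
      using boundary_dim[OF I F'S ridge] by simp
    have sc: "simplicial_complex (boundary F')"
      using boundary_simplicial[OF I(1) F'S] ridge by blast
    have "face_dim (\<sigma> - \<beta>) + face_dim \<beta> = int N - 1"
      using card\<alpha> \<beta>(2) kN by (simp add: face_dim_def)
    then have "bistellar_move (int N - 1) (boundary F') (\<sigma> - \<beta>) \<beta> (boundary F)"
      unfolding bistellar_move_def using sc dim fin\<sigma> fin\<beta> \<alpha>ne \<beta>ne ind new by auto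
    moreover have "face_dim \<beta> < int k" using \<beta>(2) by (simp add: face_dim_def)
    ultimately show ?thesis by (rule stellated_sphere.move[OF IH])
  qed
qed

section \<open>Counting sign changes outward from a base position\<close>

text \<open>Meant for the two sequences \<open>s (i - t)\<close> and \<open>s (i + t)\<close> read
  outward from position \<open>i\<close>, so that \<open>e 0\<close> is the sign of the link
  vertex.\<close>

definition changes :: "(nat \<Rightarrow> bool) \<Rightarrow> nat \<Rightarrow> nat" where
  "changes e t = card {p. p < t \<and> e (Suc p) \<noteq> e p}"

definition variation :: "nat \<Rightarrow> (nat \<Rightarrow> bool) \<Rightarrow> nat" where
  "variation n s = card {p \<in> {1..<n}. s (Suc p) \<noteq> s p}"

text \<open>A rank function for the pointwise order of the counts. Position \<open>i\<close> occurs
  in both sums, with count 0.\<close>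

definition potential :: "nat \<Rightarrow> nat \<Rightarrow> (nat \<Rightarrow> bool) \<Rightarrow> nat" where
  "potential n i s =
     (\<Sum>t<i. changes (\<lambda>t. s (i - t)) t) + (\<Sum>t\<le>n - i. changes (\<lambda>t. s (i + t)) t)"

lemma changes_0 [simp]: "changes e 0 = 0"
  by (simp add: changes_def)

lemma changes_Suc [simp]:
  "changes e (Suc t) = changes e t + (if e (Suc t) \<noteq> e t then 1 else 0)"
proof -
  have "{p. p < Suc t \<and> e (Suc p) \<noteq> e p} =
      (if e (Suc t) \<noteq> e t then insert t {p. p < t \<and> e (Suc p) \<noteq> e p}
       else {p. p < t \<and> e (Suc p) \<noteq> e p})"
    by (auto simp: less_Suc_eq)
  then show ?thesis by (simp add: changes_def)
qed

text \<open>Each change toggles the sign.\<close>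

lemma odd_changes: "odd (changes e t) \<longleftrightarrow> e t \<noteq> e 0"
  by (induction t) auto

text \<open>The hypotheses leave \<open>b + 1\<close> as the only bad value of \<open>a\<close>, and
  parity excludes it. This recovers the one unit that the inductions below could lose in a
  step.\<close>

lemma le_if_same_parity:
  fixes a b c :: nat
  shows "(odd a \<longleftrightarrow> odd b) \<Longrightarrow> c \<le> b \<Longrightarrow> a \<le> c + 1 \<Longrightarrow> a \<le> b"
  by presburger

text \<open>The count of \<open>e\<close> grows only at its changes; there \<open>f\<close> agrees
  with \<open>e\<close>, so the parities match and \<open>e\<close> cannot get ahead by one.\<close>

lemma changes_le_if_agree_at_changes:
  assumes "f 0 = e 0" "\<And>t. t < N \<Longrightarrow> e (Suc t) \<noteq> e t \<Longrightarrow> f (Suc t) = e (Suc t)" "t \<le> N"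
  shows "changes e t \<le> changes f t"
  using assms(3)
proof (induction t)
  case (Suc t)
  then have IH: "changes e t \<le> changes f t" by simp
  show ?case
  proof (cases "e (Suc t) = e t")
    case False
    then have "odd (changes e (Suc t)) \<longleftrightarrow> odd (changes f (Suc t))"
      using assms(1) assms(2)[of t] Suc.prems unfolding odd_changes by simp
    then show ?thesis by (rule le_if_same_parity[where c = "changes f t"]) (use IH in simp_all)
  qed (use IH in simp)
qed simp

text \<open>At a change of \<open>e\<close> both counts may grow, which keeps the inequality. At a
  repeat only \<open>f\<close> can grow, and agreement there forbids an excess of one by
  parity.\<close>

lemma changes_le_if_agree_at_repeats:
  assumes "f 0 = e 0" "\<And>t. t < N \<Longrightarrow> e (Suc t) = e t \<Longrightarrow> f (Suc t) = e (Suc t)" "t \<le> N"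
  shows "changes f t \<le> changes e t"
  using assms(3)
proof (induction t)
  case (Suc t)
  then have IH: "changes f t \<le> changes e t" by simp
  show ?case
  proof (cases "e (Suc t) = e t")
    case True
    then have "odd (changes f (Suc t)) \<longleftrightarrow> odd (changes e (Suc t))"
      using assms(1) assms(2)[of t] Suc.prems unfolding odd_changes by simp
    then show ?thesis
      by (rule le_if_same_parity[where c = "changes f t"]) (use IH True in simp_all)
  qed (use IH in simp)
qed simp

text \<open>Every pair of neighbouring positions lies on one side of \<open>i\<close>. This ties the
  bound on sign changes to the counts at the two ends.\<close>

lemma variation_split:
  assumes "1 \<le> i" "i \<le> n"
  shows "variation n s = changes (\<lambda>t. s (i - t)) (i - 1) + changes (\<lambda>t. s (i + t)) (n - i)"
proof -
  let ?L = "{p. p < i - 1 \<and> s (i - Suc p) \<noteq> s (i - p)}"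
  let ?R = "{p. p < n - i \<and> s (i + Suc p) \<noteq> s (i + p)}"
  have "{p \<in> {1..<n}. s (Suc p) \<noteq> s p} = (\<lambda>p. i - Suc p) ` ?L \<union> (\<lambda>p. i + p) ` ?R"
  proof (intro set_eqI iffI)
    fix p assume p: "p \<in> {p \<in> {1..<n}. s (Suc p) \<noteq> s p}"
    show "p \<in> (\<lambda>p. i - Suc p) ` ?L \<union> (\<lambda>p. i + p) ` ?R"
    proof (cases "p < i")
      case True
      then have "i - Suc (i - Suc p) = p" "i - (i - Suc p) = Suc p" by auto
      then have "p \<in> (\<lambda>p. i - Suc p) ` ?L"
        using p True by (intro image_eqI[of _ _ "i - Suc p"]) auto
      then show ?thesis by blast
    next
      case False
      then have "p \<in> (\<lambda>p. i + p) ` ?R" using p by (intro image_eqI[of _ _ "p - i"]) auto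
      then show ?thesis by blast
    qed
  next
    fix q assume "q \<in> (\<lambda>p. i - Suc p) ` ?L \<union> (\<lambda>p. i + p) ` ?R"
    then show "q \<in> {p \<in> {1..<n}. s (Suc p) \<noteq> s p}"
    proof
      assume "q \<in> (\<lambda>p. i - Suc p) ` ?L"
      then obtain p where p: "q = i - Suc p" "p < i - 1" "s (i - Suc p) \<noteq> s (i - p)" by auto
      moreover have "Suc (i - Suc p) = i - p" using p by simp
      ultimately show ?thesis using assms by auto
    qed (use assms in auto)
  qed
  moreover have "card ((\<lambda>p. i - Suc p) ` ?L \<union> (\<lambda>p. i + p) ` ?R)
      = card ((\<lambda>p. i - Suc p) ` ?L) + card ((\<lambda>p. i + p) ` ?R)"
    using assms by (intro card_Un_disjoint) auto
  moreover have "card ((\<lambda>p. i - Suc p) ` ?L) = card ?L" by (intro card_image inj_onI) auto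
  moreover have "card ((\<lambda>p. i + p) ` ?R) = card ?R" by (intro card_image inj_onI) auto
  ultimately show ?thesis by (simp add: variation_def changes_def)
qed

text \<open>Strictness comes from position \<open>j\<close>: the signs differ there but agree at
  \<open>i\<close>, so the two counts at \<open>j\<close> have different parity.\<close>

lemma potential_less:
  assumes i: "1 \<le> i" "i \<le> n" and "s i = s' i"
    and L: "\<And>t. t < i \<Longrightarrow> changes (\<lambda>t. s (i - t)) t \<le> changes (\<lambda>t. s' (i - t)) t"
    and R: "\<And>t. t \<le> n - i \<Longrightarrow> changes (\<lambda>t. s (i + t)) t \<le> changes (\<lambda>t. s' (i + t)) t"
    and j: "1 \<le> j" "j \<le> n" "s j \<noteq> s' j"
  shows "potential n i s < potential n i s'"
proof (cases "j < i")
  case True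
  then have "changes (\<lambda>t. s (i - t)) (i - j) \<noteq> changes (\<lambda>t. s' (i - t)) (i - j)"
    using odd_changes[of "\<lambda>t. s (i - t)" "i - j"] odd_changes[of "\<lambda>t. s' (i - t)" "i - j"]
      assms True by auto
  then have "changes (\<lambda>t. s (i - t)) (i - j) < changes (\<lambda>t. s' (i - t)) (i - j)"
    using L[of "i - j"] j True by simp
  then have "(\<Sum>t<i. changes (\<lambda>t. s (i - t)) t) < (\<Sum>t<i. changes (\<lambda>t. s' (i - t)) t)"
    using L j True by (intro sum_strict_mono_ex1) (auto intro!: bexI[of _ "i - j"])
  then show ?thesis unfolding potential_def using R by (intro add_less_le_mono sum_mono) auto
next
  case False
  have "changes (\<lambda>t. s (i + t)) (j - i) \<noteq> changes (\<lambda>t. s' (i + t)) (j - i)"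
    using odd_changes[of "\<lambda>t. s (i + t)" "j - i"] odd_changes[of "\<lambda>t. s' (i + t)" "j - i"]
      assms False by auto
  then have "changes (\<lambda>t. s (i + t)) (j - i) < changes (\<lambda>t. s' (i + t)) (j - i)"
    using R[OF diff_le_mono[OF j(2), of i]] by simp
  then have "(\<Sum>t\<le>n - i. changes (\<lambda>t. s (i + t)) t) < (\<Sum>t\<le>n - i. changes (\<lambda>t. s' (i + t)) t)"
    using R j False by (intro sum_strict_mono_ex1) (auto intro!: bexI[of _ "j - i"])
  then show ?thesis unfolding potential_def using L by (intro add_le_less_mono sum_mono) auto
qed

section \<open>The restriction of a facet and the shelling of a vertex link\<close>

definition signs :: "kn_vertex set \<Rightarrow> nat \<Rightarrow> bool" where
  "signs \<sigma> j \<longleftrightarrow> (j, True) \<in> \<sigma>"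

text \<open>The restriction R. Signs are read after inserting \<open>v\<close>, so that the
  positions next to \<open>v\<close> also have a neighbour to compare with; the \<open>if\<close>
  selects the neighbour towards \<open>v\<close>.\<close>

definition outer_part :: "kn_vertex \<Rightarrow> kn_vertex set \<Rightarrow> kn_vertex set" where
  "outer_part v \<sigma> =
     {(j, b) \<in> \<sigma>. b \<noteq> signs (insert v \<sigma>) (if j < fst v then Suc j else j - 1)}"

lemma signs_insert_mem:
  assumes "\<sigma> \<in> sections (I - {i})" "j \<in> I" "j \<noteq> i"
  shows "(j, signs (insert (i, b) \<sigma>) j) \<in> \<sigma>" and "(j, c) \<in> \<sigma> \<longleftrightarrow> c = signs (insert (i, b) \<sigma>) j"
proof -
  have "signs (insert (i, b) \<sigma>) j \<longleftrightarrow> (j, True) \<in> \<sigma>" using assms(3) by (simp add: signs_def)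
  then have *: "(j, c) \<in> \<sigma> \<longleftrightarrow> c = signs (insert (i, b) \<sigma>) j" for c
    using sections_mem_iff[OF assms(1), of j c] assms(2,3) by blast
  show "(j, signs (insert (i, b) \<sigma>) j) \<in> \<sigma>" and "(j, c) \<in> \<sigma> \<longleftrightarrow> c = signs (insert (i, b) \<sigma>) j"
    using * by blast+
qed

lemma signs_insert_self:
  assumes "\<sigma> \<in> sections (I - {i})"
  shows "signs (insert (i, b) \<sigma>) i = b"
  using assms unfolding sections_iff signs_def by auto

lemma signs_insert_eqD:
  assumes "\<sigma> \<in> sections (I - {i})" "\<tau> \<in> sections (I - {i})" "\<tau> \<noteq> \<sigma>"
  shows "\<exists>j\<in>I. signs (insert (i, b) \<sigma>) j \<noteq> signs (insert (i, b) \<tau>) j"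
proof (rule ccontr)
  assume *: "\<not> ?thesis"
  have "(j, c) \<in> \<sigma> \<longleftrightarrow> (j, c) \<in> \<tau>" for j c
  proof (cases "j \<in> I - {i}")
    case True
    then show ?thesis
      using * signs_insert_mem(2)[OF assms(1), of j c b] signs_insert_mem(2)[OF assms(2), of j c b]
      by blast
  next
    case False
    then show ?thesis using assms unfolding sections_iff by blast
  qed
  then show False using assms(3) by auto
qed

text \<open>Each vertex of the outer part is the end, farther from \<open>i\<close>, of a sign
  change.\<close>

lemma card_outer_part:
  assumes "\<sigma> \<in> sections ({1..n} - {i})" "1 \<le> i" "i \<le> n"
  shows "card (outer_part (i, b) \<sigma>) \<le> variation n (signs (insert (i, b) \<sigma>))"
proof -
  let ?s = "signs (insert (i, b) \<sigma>)"
  let ?P = "{p \<in> {1..<n}. ?s (Suc p) \<noteq> ?s p}"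
  \<comment> \<open>Sends the change between \<open>p\<close> and \<open>Suc p\<close> to its end
    farther from \<open>i\<close>.\<close>
  let ?g = "\<lambda>p. if p < i then (p, ?s p) else (Suc p, ?s (Suc p))"
  have "outer_part (i, b) \<sigma> \<subseteq> ?g ` ?P"
  proof
    fix x assume x: "x \<in> outer_part (i, b) \<sigma>"
    obtain j c where jc: "x = (j, c)" by (cases x)
    have \<sigma>: "(j, c) \<in> \<sigma>" and c: "c \<noteq> ?s (if j < i then Suc j else j - 1)"
      using x jc by (auto simp: outer_part_def)
    have j: "1 \<le> j" "j \<le> n" "j \<noteq> i" using \<sigma> assms(1) by (auto simp: sections_iff)
    have cs: "c = ?s j" using signs_insert_mem(2)[OF assms(1), of j c b] j \<sigma> by simp
    show "x \<in> ?g ` ?P"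
    proof (cases "j < i")
      case True
      then show ?thesis using c cs j assms jc by (intro image_eqI[of _ _ j]) auto
    next
      case False
      then obtain p where p: "j = Suc p" "i \<le> p" using j by (cases j) auto
      then have "x = ?g p" "p \<in> ?P" using c cs j assms(2) jc by auto
      then show ?thesis by (rule image_eqI)
    qed
  qed
  then have "card (outer_part (i, b) \<sigma>) \<le> card (?g ` ?P)" by (intro card_mono) auto
  also have "\<dots> \<le> card ?P" by (intro card_image_le) auto
  finally show ?thesis by (simp add: variation_def)
qed

text \<open>The outer part records the signs at all positions where the sequence changes on the way
  out from \<open>i\<close>, so containing it means agreeing at the changes.\<close>

lemma changes_le_if_outer_part_subset:
  assumes \<sigma>: "\<sigma> \<in> sections ({1..n} - {i})" and \<tau>: "\<tau> \<in> sections ({1..n} - {i})"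
    and i: "1 \<le> i" "i \<le> n" and sub: "outer_part (i, b) \<sigma> \<subseteq> \<tau>"
  defines "s \<equiv> signs (insert (i, b) \<sigma>)" and "s' \<equiv> signs (insert (i, b) \<tau>)"
  shows "t < i \<Longrightarrow> changes (\<lambda>t. s (i - t)) t \<le> changes (\<lambda>t. s' (i - t)) t"
    and "t \<le> n - i \<Longrightarrow> changes (\<lambda>t. s (i + t)) t \<le> changes (\<lambda>t. s' (i + t)) t"
proof -
  have self: "s' i = s i"
    using signs_insert_self[OF \<sigma>] signs_insert_self[OF \<tau>] by (simp add: s_def s'_def)
  have agree: "s' j = s j"
    if "j \<in> {1..n}" "j \<noteq> i" "s j \<noteq> s (if j < i then Suc j else j - 1)" for j
  proof -
    have "(j, s j) \<in> outer_part (i, b) \<sigma>"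
      using signs_insert_mem(1)[OF \<sigma>, of j b] that by (auto simp: outer_part_def s_def)
    then show ?thesis
      using sub signs_insert_mem(2)[OF \<tau>, of j "s j" b] that by (auto simp: s'_def)
  qed
  show "changes (\<lambda>t. s (i - t)) t \<le> changes (\<lambda>t. s' (i - t)) t" if "t < i"
  proof (rule changes_le_if_agree_at_changes[where N = "i - 1"])
    fix t assume t: "t < i - 1" "s (i - Suc t) \<noteq> s (i - t)"
    then have "Suc (i - Suc t) = i - t" by simp
    then show "s' (i - Suc t) = s (i - Suc t)" using t i by (intro agree) auto
  qed (use that self in auto)
  show "changes (\<lambda>t. s (i + t)) t \<le> changes (\<lambda>t. s' (i + t)) t" if "t \<le> n - i"
  proof (rule changes_le_if_agree_at_changes[where N = "n - i"])
    fix t assume t: "t < n - i" "s (i + Suc t) \<noteq> s (i + t)"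
    then show "s' (i + Suc t) = s (i + Suc t)" using t i by (intro agree) auto
  qed (use that self in auto)
qed

text \<open>The vertices outside the outer part sit at the repeats, so here the agreement is at the
  repeats.\<close>

lemma changes_le_if_inner_part_subset:
  assumes \<sigma>: "\<sigma> \<in> sections ({1..n} - {i})" and \<tau>: "\<tau> \<in> sections ({1..n} - {i})"
    and i: "1 \<le> i" "i \<le> n" and sub: "\<sigma> - outer_part (i, b) \<sigma> \<subseteq> \<tau>"
  defines "s \<equiv> signs (insert (i, b) \<sigma>)" and "s' \<equiv> signs (insert (i, b) \<tau>)"
  shows "t < i \<Longrightarrow> changes (\<lambda>t. s' (i - t)) t \<le> changes (\<lambda>t. s (i - t)) t"
    and "t \<le> n - i \<Longrightarrow> changes (\<lambda>t. s' (i + t)) t \<le> changes (\<lambda>t. s (i + t)) t"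
proof -
  have self: "s' i = s i"
    using signs_insert_self[OF \<sigma>] signs_insert_self[OF \<tau>] by (simp add: s_def s'_def)
  have agree: "s' j = s j"
    if "j \<in> {1..n}" "j \<noteq> i" "s j = s (if j < i then Suc j else j - 1)" for j
  proof -
    have "(j, s j) \<in> \<sigma> - outer_part (i, b) \<sigma>"
      using signs_insert_mem(1)[OF \<sigma>, of j b] that by (auto simp: outer_part_def s_def)
    then show ?thesis
      using sub signs_insert_mem(2)[OF \<tau>, of j "s j" b] that by (auto simp: s'_def)
  qed
  show "changes (\<lambda>t. s' (i - t)) t \<le> changes (\<lambda>t. s (i - t)) t" if "t < i"
  proof (rule changes_le_if_agree_at_repeats[where N = "i - 1"])
    fix t assume t: "t < i - 1" "s (i - Suc t) = s (i - t)"
    then have "Suc (i - Suc t) = i - t" by simp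
    then show "s' (i - Suc t) = s (i - Suc t)" using t i by (intro agree) auto
  qed (use that self in auto)
  show "changes (\<lambda>t. s' (i + t)) t \<le> changes (\<lambda>t. s (i + t)) t" if "t \<le> n - i"
  proof (rule changes_le_if_agree_at_repeats[where N = "n - i"])
    fix t assume t: "t < n - i" "s (i + Suc t) = s (i + t)"
    then show "s' (i + Suc t) = s (i + Suc t)" using t i by (intro agree) auto
  qed (use that self in auto)
qed

definition link_facets :: "nat \<Rightarrow> nat \<Rightarrow> kn_vertex \<Rightarrow> kn_vertex set set" where
  "link_facets k n v =
     {\<sigma> \<in> sections ({1..n} - {fst v}). variation n (signs (insert v \<sigma>)) \<le> k}"

lemma stellated_sphere_link:
  assumes i: "1 \<le> i" "i \<le> n" and k: "k \<le> N" and n: "n = N + 2"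
  shows "stellated_sphere k (int N - 1) (boundary (link_facets k n (i, b)))"
proof (rule stellated_sphere_boundary[where D = "link_facets k n (i, b)" and I = "{1..n} - {i}"
      and R = "outer_part (i, b)" and \<Phi> = "\<lambda>\<sigma>. potential n i (signs (insert (i, b) \<sigma>))"])
  let ?D = "link_facets k n (i, b)" and ?S = "\<lambda>\<sigma>. signs (insert (i, b) \<sigma>)"
  show "finite ({1..n} - {i})" "card ({1..n} - {i}) = N + 1" "k \<le> N"
    "?D \<subseteq> sections ({1..n} - {i})" "?D \<subseteq> ?D"
    using assms by (auto simp: link_facets_def)
  show "outer_part (i, b) \<sigma> \<subseteq> \<sigma> \<and> card (outer_part (i, b) \<sigma>) \<le> k" if "\<sigma> \<in> ?D" for \<sigma>
    using card_outer_part[of \<sigma> n i b] that i by (auto simp: link_facets_def outer_part_def)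
  show "potential n i (?S \<sigma>) < potential n i (?S \<tau>)"
    if "\<sigma> \<in> ?D" "\<tau> \<in> ?D" "\<tau> \<noteq> \<sigma>" "outer_part (i, b) \<sigma> \<subseteq> \<tau>" for \<sigma> \<tau>
  proof -
    have st: "\<sigma> \<in> sections ({1..n} - {i})" "\<tau> \<in> sections ({1..n} - {i})"
      using that by (auto simp: link_facets_def)
    have "\<exists>j\<in>{1..n}. ?S \<sigma> j \<noteq> ?S \<tau> j" using signs_insert_eqD[OF st that(3)] .
    then obtain j where "j \<in> {1..n}" "?S \<sigma> j \<noteq> ?S \<tau> j" by blast
    then show ?thesis
      using i signs_insert_self[OF st(1)] signs_insert_self[OF st(2)]
        changes_le_if_outer_part_subset[OF st i that(4)]
      by (intro potential_less[where j = j]) auto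
  qed
  show "\<tau> \<in> ?D \<and> potential n i (?S \<tau>) < potential n i (?S \<sigma>)"
    if "\<sigma> \<in> ?D" "\<tau> \<in> sections ({1..n} - {i})" "\<tau> \<noteq> \<sigma>" "\<sigma> - outer_part (i, b) \<sigma> \<subseteq> \<tau>" for \<sigma> \<tau>
  proof
    have \<sigma>: "\<sigma> \<in> sections ({1..n} - {i})" using that by (auto simp: link_facets_def)
    note le = changes_le_if_inner_part_subset[OF \<sigma> that(2) i that(4)]
    \<comment> \<open>The counts at both ends do not increase, and they add up to the
      variation.\<close>
    have "variation n (?S \<tau>) \<le> variation n (?S \<sigma>)"
      unfolding variation_split[OF i] using i by (intro add_mono le) auto
    then show "\<tau> \<in> ?D" using that by (auto simp: link_facets_def)
    have "\<exists>j\<in>{1..n}. ?S \<sigma> j \<noteq> ?S \<tau> j" using signs_insert_eqD[OF \<sigma> that(2,3)] .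
    then obtain j where "j \<in> {1..n}" "?S \<tau> j \<noteq> ?S \<sigma> j" by metis
    then show "potential n i (?S \<tau>) < potential n i (?S \<sigma>)"
      using i signs_insert_self[OF \<sigma>] signs_insert_self[OF that(2)] le
      by (intro potential_less[where j = j]) auto
  qed
  \<comment> \<open>The constant vector with the sign of the link vertex has no changes.\<close>
  have "(\<lambda>j. (j, b)) ` ({1..n} - {i}) \<in> ?D"
  proof -
    have "(\<lambda>j. (j, b)) ` ({1..n} - {i}) \<in> sections ({1..n} - {i})" by (auto simp: sections_def)
    moreover have "?S ((\<lambda>j. (j, b)) ` ({1..n} - {i})) j = b" if "j \<in> {1..n}" for j
      using that by (cases b) (auto simp: signs_def)
    then have "variation n (?S ((\<lambda>j. (j, b)) ` ({1..n} - {i}))) = 0"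
      unfolding variation_def by auto
    ultimately show ?thesis by (auto simp: link_facets_def)
  qed
  then show "?D \<noteq> {}" by blast
qed

section \<open>The Klee-Novik ball, its boundary and the links of its vertices\<close>

definition ball_facets :: "nat \<Rightarrow> nat \<Rightarrow> kn_vertex set set" where
  "ball_facets k n = {\<sigma> \<in> sections {1..n}. variation n (signs \<sigma>) \<le> k}"

lemma ball_facets_subset_sections: "ball_facets k n \<subseteq> sections {1..n}"
  by (auto simp: ball_facets_def)

lemma sections_Diff_vertex: "\<sigma> \<in> sections I \<Longrightarrow> (i, b) \<in> \<sigma> \<Longrightarrow> \<sigma> - {(i, b)} \<in> sections (I - {i})"
  by (cases b) (auto simp: sections_iff)

lemma sections_insert_vertex:
  "\<sigma> \<in> sections (I - {i}) \<Longrightarrow> i \<in> I \<Longrightarrow> insert (i, b) \<sigma> \<in> sections I"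
  by (cases b) (auto simp: sections_iff)

lemma join_of_pairs_eq:
  "join_of_pairs n = {\<sigma>. \<sigma> \<subseteq> {1..n} \<times> UNIV \<and> (\<forall>j. (j, True) \<in> \<sigma> \<longrightarrow> (j, False) \<notin> \<sigma>)}"
proof (induction n)
  case (Suc n)
  let ?P = "{vx (Suc n), vy (Suc n)}"
  show ?case
  proof (intro set_eqI iffI)
    fix \<sigma> assume "\<sigma> \<in> join_of_pairs (Suc n)"
    then obtain \<rho> \<tau> where
      "\<sigma> = \<rho> \<union> \<tau>" "\<tau> \<subset> ?P" "\<rho> \<subseteq> {1..n} \<times> UNIV" "\<forall>j. (j, True) \<in> \<rho> \<longrightarrow> (j, False) \<notin> \<rho>"
      unfolding join_of_pairs.simps Suc.IH join_def simplex_boundary_def by blast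
    then show "\<sigma> \<in> {\<sigma>. \<sigma> \<subseteq> {1..Suc n} \<times> UNIV \<and> (\<forall>j. (j, True) \<in> \<sigma> \<longrightarrow> (j, False) \<notin> \<sigma>)}"
      by fastforce
  next
    fix \<sigma> :: "kn_vertex set"
    assume \<sigma>: "\<sigma> \<in> {\<sigma>. \<sigma> \<subseteq> {1..Suc n} \<times> UNIV \<and> (\<forall>j. (j, True) \<in> \<sigma> \<longrightarrow> (j, False) \<notin> \<sigma>)}"
    have "\<sigma> = (\<sigma> - ?P) \<union> (\<sigma> \<inter> ?P)" by blast
    moreover have "\<sigma> \<inter> ?P \<in> simplex_boundary ?P" using \<sigma> by (auto simp: simplex_boundary_def)
    moreover have "\<sigma> - ?P \<in> join_of_pairs n"
    proof -
      have "(j, b) \<notin> \<sigma> - ?P" if "j = Suc n" for j b using that by (cases b) auto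
      then show ?thesis using \<sigma> unfolding Suc.IH by (fastforce simp: le_Suc_eq)
    qed
    ultimately show "\<sigma> \<in> join_of_pairs (Suc n)" unfolding join_of_pairs.simps join_def by blast
  qed
qed auto

text \<open>A face without a vertex at some position can be enlarged there; any vertex added to a
  section is opposite to one of its own.\<close>

lemma facet_join_of_pairs: "facet (join_of_pairs n) \<sigma> \<longleftrightarrow> \<sigma> \<in> sections {1..n}"
proof
  assume f: "facet (join_of_pairs n) \<sigma>"
  then have "\<sigma> \<in> join_of_pairs n" and max: "\<And>\<tau>. \<tau> \<in> join_of_pairs n \<Longrightarrow> \<not> \<sigma> \<subset> \<tau>"
    by (simp_all add: facet_def)
  then have \<sigma>: "\<sigma> \<subseteq> {1..n} \<times> UNIV" "\<forall>j. (j, True) \<in> \<sigma> \<longrightarrow> (j, False) \<notin> \<sigma>"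
    by (simp_all add: join_of_pairs_eq)
  have "(j, True) \<in> \<sigma>" if "j \<in> {1..n}" "(j, False) \<notin> \<sigma>" for j
  proof (rule ccontr)
    assume "(j, True) \<notin> \<sigma>"
    then have "\<sigma> \<subset> insert (j, True) \<sigma>" by blast
    moreover have "insert (j, True) \<sigma> \<in> join_of_pairs n"
      using \<sigma> that unfolding join_of_pairs_eq by auto
    ultimately show False using max[of "insert (j, True) \<sigma>"] by simp
  qed
  then show "\<sigma> \<in> sections {1..n}" using \<sigma> unfolding sections_iff by blast
next
  assume \<sigma>: "\<sigma> \<in> sections {1..n}"
  have "\<not> \<sigma> \<subset> \<tau>" if \<tau>: "\<tau> \<in> join_of_pairs n" for \<tau>
  proof
    assume sub: "\<sigma> \<subset> \<tau>"
    then obtain j c where jc: "(j, c) \<in> \<tau>" "(j, c) \<notin> \<sigma>" by auto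
    then have "j \<in> {1..n}" using \<tau> unfolding join_of_pairs_eq by blast
    then have "(j, \<not> c) \<in> \<sigma>" using jc \<sigma> unfolding sections_iff by (cases c) auto
    then have "(j, \<not> c) \<in> \<tau>" using sub by auto
    then show False using jc \<tau> unfolding join_of_pairs_eq by (cases c) auto
  qed
  moreover have "\<sigma> \<in> join_of_pairs n" using \<sigma> unfolding join_of_pairs_eq sections_iff by auto
  ultimately show "facet (join_of_pairs n) \<sigma>" by (auto simp: facet_def)
qed

lemma sections_subset_eq:
  assumes "finite I" "\<sigma> \<in> sections I" "\<tau> \<in> sections I" "\<sigma> \<subseteq> \<tau>"
  shows "\<sigma> = \<tau>"
  using assms sections_card sections_finite by (intro card_subset_eq) auto

lemma generated_complex_iff: "\<rho> \<in> generated_complex F \<longleftrightarrow> \<rho> = {} \<or> (\<exists>\<sigma>\<in>F. \<rho> \<subseteq> \<sigma>)"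
  by (auto simp: generated_complex_def)

text \<open>Sections have equal size and so form an antichain. For empty \<open>K\<close> the empty
  face would be a facet.\<close>

lemma facet_generated_complex_sections:
  assumes "finite I" "K \<subseteq> sections I" "K \<noteq> {}"
  shows "facet (generated_complex K) \<sigma> \<longleftrightarrow> \<sigma> \<in> K"
proof
  assume f: "facet (generated_complex K) \<sigma>"
  obtain \<tau> where \<tau>: "\<tau> \<in> K" "\<sigma> \<subseteq> \<tau>"
    using f assms(3) unfolding facet_def generated_complex_def by blast
  then have "\<tau> \<in> generated_complex K" unfolding generated_complex_def by blast
  then show "\<sigma> \<in> K" using f \<tau> unfolding facet_def by blast
next
  assume \<sigma>: "\<sigma> \<in> K"
  have "\<not> \<sigma> \<subset> \<tau>" if \<tau>: "\<tau> \<in> generated_complex K" for \<tau>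
  proof
    assume sub: "\<sigma> \<subset> \<tau>"
    then obtain \<upsilon> where \<upsilon>: "\<upsilon> \<in> K" "\<tau> \<subseteq> \<upsilon>" using \<tau> unfolding generated_complex_def by blast
    then have "\<sigma> = \<upsilon>" using sections_subset_eq[of I \<sigma> \<upsilon>] assms \<sigma> sub by blast
    then show False using \<upsilon> sub by blast
  qed
  then show "facet (generated_complex K) \<sigma>"
    using \<sigma> unfolding facet_def generated_complex_def by blast
qed

lemma klee_novik_ball_eq: "klee_novik_ball k d = generated_complex (ball_facets k (d + 2))"
proof -
  have "sign_changes d \<sigma> = variation (d + 2) (signs \<sigma>)" for \<sigma>
    unfolding sign_changes_def variation_def signs_def
    by (rule arg_cong[where f = card]) auto
  then show ?thesis
    unfolding klee_novik_ball_def ball_facets_def cross_sphere_def facet_join_of_pairs by simp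
qed

text \<open>Both sides have the same ridges: lying in a unique facet means that the flip is missing.
  The hypothesis takes care of the empty face, which \<open>generated_complex\<close> always
  contains.\<close>

lemma klee_novik_eq_boundary:
  assumes ne: "boundary (ball_facets k (d + 2)) \<noteq> {}"
  shows "klee_novik k d = boundary (ball_facets k (d + 2))"
proof -
  let ?K = "ball_facets k (d + 2)"
  define T where "T = {\<tau> \<in> generated_complex ?K. face_dim \<tau> = int d \<and> (\<exists>!\<sigma>. \<sigma> \<in> ?K \<and> \<tau> \<subseteq> \<sigma>)}"
  have K: "?K \<subseteq> sections {1..d + 2}" by (rule ball_facets_subset_sections)
  have "?K \<noteq> {}" using ne by (auto simp: boundary_def)
  then have T: "klee_novik k d = generated_complex T"
    unfolding klee_novik_def klee_novik_ball_eq T_def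
    using facet_generated_complex_sections[OF _ K] by simp
  have cardK: "card \<sigma> = d + 2" "finite \<sigma>" if "\<sigma> \<in> ?K" for \<sigma>
    using sections_card[of \<sigma> "{1..d + 2}"] sections_finite[of "{1..d + 2}" \<sigma>] that K by auto
  have "\<rho> \<in> generated_complex T \<longleftrightarrow> \<rho> \<in> boundary ?K" for \<rho>
  proof
    assume "\<rho> \<in> boundary ?K"
    then obtain \<sigma> v where \<sigma>: "\<sigma> \<in> ?K" "v \<in> \<sigma>" "flip v \<sigma> \<notin> ?K" "\<rho> \<subseteq> \<sigma> - {v}"
      unfolding boundary_def by auto
    have "\<tau> = \<sigma>" if "\<tau> \<in> ?K" "\<sigma> - {v} \<subseteq> \<tau>" for \<tau>
      using sections_facet_through_ridge[of \<sigma> _ v \<tau>] that \<sigma> K by blast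
    moreover have "face_dim (\<sigma> - {v}) = int d" using cardK[OF \<sigma>(1)] \<sigma>(2) by (simp add: face_dim_def)
    moreover have "\<sigma> - {v} \<in> generated_complex ?K" using \<sigma> unfolding generated_complex_def by blast
    ultimately have "\<sigma> - {v} \<in> T" using \<sigma>(1) unfolding T_def by blast
    then show "\<rho> \<in> generated_complex T" using \<sigma>(4) unfolding generated_complex_iff by blast
  next
    assume "\<rho> \<in> generated_complex T"
    then consider "\<rho> = {}" | \<tau> where "\<tau> \<in> T" "\<rho> \<subseteq> \<tau>" unfolding generated_complex_iff by blast
    then show "\<rho> \<in> boundary ?K"
    proof cases
      case 1
      then show ?thesis using ne boundary_mono_face by blast
    next
      case 2
      then obtain \<sigma> where \<sigma>: "\<sigma> \<in> ?K" "\<tau> \<subseteq> \<sigma>" "\<And>\<sigma>'. \<sigma>' \<in> ?K \<Longrightarrow> \<tau> \<subseteq> \<sigma>' \<Longrightarrow> \<sigma>' = \<sigma>"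
        unfolding T_def by blast
      have "card \<tau> = d + 1" using 2(1) by (auto simp: T_def face_dim_def)
      then have "\<tau> \<noteq> \<sigma>" using cardK[OF \<sigma>(1)] by auto
      then obtain v where v: "v \<in> \<sigma>" "v \<notin> \<tau>" using \<sigma>(2) by blast
      have "flip v \<sigma> \<notin> ?K"
      proof
        assume "flip v \<sigma> \<in> ?K"
        moreover have "\<tau> \<subseteq> flip v \<sigma>" using v \<sigma>(2) by (auto simp: flip_def)
        ultimately show False using \<sigma>(3) flip_neq[OF v(1)] by blast
      qed
      then show ?thesis using \<sigma> v 2(2) unfolding boundary_def by blast
    qed
  qed
  then show ?thesis using T by blast
qed

text \<open>Flipping a vertex at another position commutes with inserting or deleting
  \<open>(i, b)\<close>, and \<open>link_facets\<close> counts changes with this vertex put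
  back.\<close>

lemma link_boundary_ball_facets:
  assumes i: "i \<in> {1..n}"
  shows "link (boundary (ball_facets k n)) (i, b) = boundary (link_facets k n (i, b))"
proof (intro set_eqI iffI)
  let ?v = "(i, b)"
  have ins: "insert ?v \<sigma> \<in> ball_facets k n" if "\<sigma> \<in> link_facets k n ?v" for \<sigma>
    using that sections_insert_vertex[OF _ i] by (auto simp: ball_facets_def link_facets_def)
  have del: "\<sigma> - {?v} \<in> link_facets k n ?v" if "\<sigma> \<in> ball_facets k n" "?v \<in> \<sigma>" for \<sigma>
    using that sections_Diff_vertex[of \<sigma> "{1..n}" i b]
    by (auto simp: ball_facets_def link_facets_def insert_absorb)
  {
    fix \<rho> assume "\<rho> \<in> link (boundary (ball_facets k n)) ?v"
    then have "?v \<notin> \<rho>" "insert ?v \<rho> \<in> boundary (ball_facets k n)" by (auto simp: link_def)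
    then obtain \<sigma> w where \<sigma>: "\<sigma> \<in> ball_facets k n" "w \<in> \<sigma>" "flip w \<sigma> \<notin> ball_facets k n"
      "insert ?v \<rho> \<subseteq> \<sigma> - {w}" unfolding boundary_def by auto
    have v: "?v \<in> \<sigma>" "?v \<noteq> w" using \<sigma>(4) by auto
    have "insert ?v (flip w (\<sigma> - {?v})) = flip w \<sigma>" using v by (auto simp: flip_def)
    then have "flip w (\<sigma> - {?v}) \<notin> link_facets k n ?v" using ins \<sigma>(3) by metis
    moreover have "\<rho> \<subseteq> \<sigma> - {?v} - {w}" using \<sigma>(4) \<open>?v \<notin> \<rho>\<close> by auto
    moreover have "w \<in> \<sigma> - {?v}" using \<sigma>(2) v by auto
    ultimately show "\<rho> \<in> boundary (link_facets k n ?v)"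
      unfolding boundary_def using del[OF \<sigma>(1) v(1)] by blast
  next
    fix \<rho> assume "\<rho> \<in> boundary (link_facets k n ?v)"
    then obtain \<sigma> w where \<sigma>: "\<sigma> \<in> link_facets k n ?v" "w \<in> \<sigma>" "flip w \<sigma> \<notin> link_facets k n ?v"
      "\<rho> \<subseteq> \<sigma> - {w}" unfolding boundary_def by auto
    have sec: "\<sigma> \<in> sections ({1..n} - {i})" using \<sigma>(1) by (simp add: link_facets_def)
    then have out: "?v \<notin> \<sigma>" "fst w \<noteq> i" using \<sigma>(2) by (cases w; auto simp: sections_iff)+
    have "flip w (insert ?v \<sigma>) - {?v} = flip w \<sigma>" using out by (auto simp: flip_def)
    moreover have "?v \<in> flip w (insert ?v \<sigma>)" using out by (auto simp: flip_def)
    ultimately have "flip w (insert ?v \<sigma>) \<notin> ball_facets k n" using del \<sigma>(3) by metis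
    moreover have "insert ?v \<rho> \<subseteq> insert ?v \<sigma> - {w}" using \<sigma>(4) out by auto
    ultimately have "insert ?v \<rho> \<in> boundary (ball_facets k n)"
      unfolding boundary_def using ins[OF \<sigma>(1)] \<sigma>(2) by blast
    moreover have "?v \<notin> \<rho>" using \<sigma>(4) out by auto
    ultimately show "\<rho> \<in> link (boundary (ball_facets k n)) ?v"
      using boundary_mono_face by (auto simp: link_def)
  }
qed

section \<open>Boundary ridges through prescribed vertices, and connectedness\<close>

text \<open>Yields both the dimension of the boundary and all edges between consecutive positions.
  Position 1 is reserved for the flip that leaves the ball, hence \<open>m\<close> starts at
  2.\<close>

lemma boundary_ball_facets_ridge:
  assumes k: "1 \<le> k" "2 * k \<le> d" and m: "2 \<le> m" "m \<le> d + 1"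
  obtains \<tau> where "\<tau> \<in> boundary (ball_facets k (d + 2))" "card \<tau> = d + 1"
    "(m, a) \<in> \<tau>" "(Suc m, b) \<in> \<tau>"
proof -
  let ?n = "d + 2"
  \<comment> \<open>Whether the sign changes after \<open>m\<close> is dictated by \<open>a\<close>
    and \<open>b\<close>; the other changes are free among \<open>d - 1\<close> places, and
    \<open>k\<close> is at most \<open>d - 1\<close> because \<open>1 \<le> k\<close> and
    \<open>2 * k \<le> d\<close>.\<close>
  obtain S where S: "S \<subseteq> {2..d + 1}" "card S = k" "m \<in> S \<longleftrightarrow> a \<noteq> b"
  proof (cases "a = b")
    case True
    have "k \<le> card ({2..d + 1} - {m})" using k m by simp
    then obtain S where "S \<subseteq> {2..d + 1} - {m}" "card S = k" by (rule obtain_subset_with_card_n)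
    then show ?thesis using True by (intro that[of S]) auto
  next
    case False
    have "k - 1 \<le> card ({2..d + 1} - {m})" using k m by simp
    then obtain S where S: "S \<subseteq> {2..d + 1} - {m}" "card S = k - 1"
      by (rule obtain_subset_with_card_n)
    then have "finite S" "m \<notin> S" using finite_subset by blast+
    then have "card (insert m S) = k" using S k by simp
    then show ?thesis using False S m by (intro that[of "insert m S"]) auto
  qed
  have S': "insert 1 S \<subseteq> {1..<?n}" using S(1) by auto
  have finS: "finite S" using S(1) finite_subset by blast
  \<comment> \<open>A sign vector whose set of sign changes is S. As 1 is not in S, flipping the sign at position 1
    creates one more sign change, which exceeds k.\<close>
  define c where "c p = odd (card {q \<in> S. q < p})" for p
  have step: "c (Suc p) \<noteq> c p \<longleftrightarrow> p \<in> S" for p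
  proof -
    have "{q \<in> S. q < Suc p} = (if p \<in> S then insert p {q \<in> S. q < p} else {q \<in> S. q < p})"
      by (auto simp: less_Suc_eq)
    then show ?thesis using finS by (simp add: c_def)
  qed
  \<comment> \<open>Either \<open>c\<close> or its negation, whichever has the sign \<open>a\<close>
    at \<open>m\<close>; the places of change stay the same.\<close>
  define e where "e p = (c p = (a = c m))" for p
  have e_step: "e (Suc p) \<noteq> e p \<longleftrightarrow> p \<in> S" for p using step[of p] by (auto simp: e_def)
  have em: "e m = a" by (auto simp: e_def)
  then have eSm: "e (Suc m) = b" using e_step[of m] S(3) by auto
  define \<sigma> where "\<sigma> = (\<lambda>j. (j, e j)) ` {1..?n}"
  have sec: "\<sigma> \<in> sections {1..?n}" by (auto simp: \<sigma>_def sections_def)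
  have s\<sigma>: "signs \<sigma> j = e j" if "j \<in> {1..?n}" for j using that by (auto simp: signs_def \<sigma>_def)
  have "signs \<sigma> (Suc p) \<noteq> signs \<sigma> p \<longleftrightarrow> p \<in> S" if "p \<in> {1..<?n}" for p
    using s\<sigma>[of p] s\<sigma>[of "Suc p"] e_step[of p] that by auto
  then have "{p \<in> {1..<?n}. signs \<sigma> (Suc p) \<noteq> signs \<sigma> p} = S" using S' by blast
  then have "\<sigma> \<in> ball_facets k ?n" using sec S(2) by (simp add: ball_facets_def variation_def)
  moreover have "flip (1, e 1) \<sigma> \<notin> ball_facets k ?n"
  proof -
    let ?s = "signs (flip (1, e 1) \<sigma>)"
    have s1: "?s 1 = (\<not> e 1)" by (auto simp: signs_def flip_def \<sigma>_def)
    have s: "?s j = e j" if "j \<in> {2..?n}" for j using that by (auto simp: signs_def flip_def \<sigma>_def)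
    have "1 \<notin> S" using S(1) by auto
    have "?s (Suc p) \<noteq> ?s p \<longleftrightarrow> p \<in> insert 1 S" if "p \<in> {1..<?n}" for p
    proof (cases "p = 1")
      case True
      then show ?thesis using s1 s[of 2] e_step[of 1] \<open>1 \<notin> S\<close> by (auto simp: numeral_2_eq_2)
    next
      case False
      then show ?thesis using s[of p] s[of "Suc p"] e_step[of p] that by auto
    qed
    then have "{p \<in> {1..<?n}. ?s (Suc p) \<noteq> ?s p} = insert 1 S" using S' by blast
    then show ?thesis using finS \<open>1 \<notin> S\<close> S(2) by (simp add: ball_facets_def variation_def)
  qed
  moreover have "(1, e 1) \<in> \<sigma>" by (auto simp: \<sigma>_def)
  ultimately have "\<sigma> - {(1, e 1)} \<in> boundary (ball_facets k ?n)" unfolding boundary_def by blast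
  moreover have "card (\<sigma> - {(1, e 1)}) = d + 1"
    using sections_card[OF sec] sections_finite[OF _ sec] \<open>(1, e 1) \<in> \<sigma>\<close> by simp
  moreover have "(m, a) \<in> \<sigma> - {(1, e 1)}" "(Suc m, b) \<in> \<sigma> - {(1, e 1)}"
    using m em eSm by (auto simp: \<sigma>_def)
  ultimately show ?thesis by (rule that)
qed

lemma connected_boundary_ball_facets:
  assumes k: "1 \<le> k" "2 * k \<le> d"
  shows "connected_complex (boundary (ball_facets k (d + 2)))"
proof -
  let ?B = "boundary (ball_facets k (d + 2))"
  let ?E = "{(a, b). {a, b} \<in> ?B}"
  have edge: "((m, a), (Suc m, b)) \<in> ?E" if m: "2 \<le> m" "m \<le> d + 1" for m a b
  proof -
    obtain \<tau> where "\<tau> \<in> ?B" "(m, a) \<in> \<tau>" "(Suc m, b) \<in> \<tau>"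
      using boundary_ball_facets_ridge[OF k m] by metis
    then show ?thesis using boundary_mono_face[of \<tau> _ "{(m, a), (Suc m, b)}"] by auto
  qed
  have "sym ?E" by (auto simp: sym_def insert_commute)
  then have symE: "sym (?E\<^sup>*)" by (rule sym_rtrancl)
  have edge': "((Suc m, b), (m, a)) \<in> ?E" if "2 \<le> m" "m \<le> d + 1" for m a b
    using edge[OF that] \<open>sym ?E\<close> by (meson symD)
  have conn: "((j, a), (2, True)) \<in> ?E\<^sup>*" if j: "2 \<le> j" "j \<le> d + 2" for j a
    using j
  proof (induction j arbitrary: a rule: dec_induct)
    case base
    \<comment> \<open>The two vertices at position 2 are opposite and share no face, so the path
      goes through position 3.\<close>
    have "((2, a), (Suc 2, True)) \<in> ?E" using k by (intro edge) auto
    moreover have "((Suc 2, True), (2, True)) \<in> ?E" using k by (intro edge') auto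
    ultimately show ?case by (meson converse_rtrancl_into_rtrancl rtrancl.rtrancl_refl)
  next
    case (step j)
    have "((Suc j, a), (j, True)) \<in> ?E" using step by (intro edge') auto
    moreover have "((j, True), (2, True)) \<in> ?E\<^sup>*" using step by simp
    ultimately show ?case by (rule converse_rtrancl_into_rtrancl)
  qed
  have "(u, (2, True)) \<in> ?E\<^sup>*" if u: "u \<in> vertices ?B" for u
  proof -
    obtain i b where ib: "u = (i, b)" by (cases u)
    obtain \<sigma> w where \<sigma>: "\<sigma> \<in> ball_facets k (d + 2)" "w \<in> \<sigma>" "flip w \<sigma> \<notin> ball_facets k (d + 2)"
      "u \<in> \<sigma> - {w}" using u unfolding vertices_def boundary_def by auto
    have sec: "\<sigma> \<in> sections {1..d + 2}" using \<sigma>(1) ball_facets_subset_sections by blast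
    have i: "1 \<le> i" "i \<le> d + 2" using sec \<sigma>(4) ib by (auto simp: sections_iff)
    \<comment> \<open>The ridge omits only the position of \<open>w\<close>, so it has a vertex at
      position 2 or 3, and every vertex \<open>u\<close> of it is joined to that one. This covers
      \<open>u\<close> at position 1, which the consecutive edges do not reach.\<close>
    define j :: nat where "j = (if fst w = 2 then 3 else 2)"
    have j: "2 \<le> j" "j \<le> d + 2" "j \<noteq> fst w" using k by (auto simp: j_def)
    then have "(j, True) \<in> \<sigma> \<or> (j, False) \<in> \<sigma>" using sec by (auto simp: sections_iff)
    then obtain c where c: "(j, c) \<in> \<sigma>" by blast
    then have "{u, (j, c)} \<subseteq> \<sigma> - {w}" using \<sigma>(4) j by auto
    then have "(u, (j, c)) \<in> ?E" using \<sigma> unfolding boundary_def by blast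
    then show ?thesis using conn[OF j(1,2)] by (rule converse_rtrancl_into_rtrancl)
  qed
  then show ?thesis
    unfolding connected_complex_def using symE by (meson rtrancl_trans symD)
qed

theorem mainTheorem17:
  fixes k d :: nat
  assumes "d \<ge> 1" and "k \<ge> 1" and "d \<ge> 2 * k"
  shows "klee_novik k d \<in> walkup_class k d"
proof -
  let ?B = "boundary (ball_facets k (d + 2))"
  have K: "ball_facets k (d + 2) \<subseteq> sections {1..d + 2}" by (rule ball_facets_subset_sections)
  \<comment> \<open>One ridge, at \<open>m = 2\<close>, gives nonemptiness and the
    dimension.\<close>
  have "1 \<le> k" "2 * k \<le> d" "(2 :: nat) \<le> 2" "2 \<le> d + 1" using assms by auto
  then obtain \<tau> where \<tau>: "\<tau> \<in> ?B" "card \<tau> = d + 1" "(2, True) \<in> \<tau>" "(Suc 2, True) \<in> \<tau>"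
    by (rule boundary_ball_facets_ridge)
  then have ne: "?B \<noteq> {}" by blast
  have "simplicial_complex ?B" using boundary_simplicial[OF _ K ne] by simp
  moreover have "complex_dim ?B = int d" using boundary_dim[OF _ _ K \<tau>(1), of "d + 1"] \<tau>(2) by simp
  moreover have "connected_complex ?B" using connected_boundary_ball_facets assms by blast
  moreover have "stellated_sphere k (int d - 1) (link ?B v)" if v: "v \<in> vertices ?B" for v
  proof -
    obtain i b where ib: "v = (i, b)" by (cases v)
    obtain \<sigma> where "\<sigma> \<in> ball_facets k (d + 2)" "v \<in> \<sigma>"
      using v unfolding vertices_def boundary_def by auto
    then have i: "i \<in> {1..d + 2}" using K ib by (auto simp: sections_def)
    have "stellated_sphere k (int d - 1) (boundary (link_facets k (d + 2) (i, b)))"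
      using i assms by (intro stellated_sphere_link) auto
    then show ?thesis using link_boundary_ball_facets[OF i] ib by simp
  qed
  ultimately show ?thesis
    unfolding klee_novik_eq_boundary[OF ne] walkup_class_def by blast
qed

end
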